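(* Let $\phi_0$ and $g_0$ be constant $m\times m$ matrices, $g_0$ invertible. Let $\boldsymbol{P}$ and $\boldsymbol{Q}$ be solutions of the $n\times n$ matrix Riemann equations $$\boldsymbol{P}_y=-\boldsymbol{P}_z\,\boldsymbol{P},\qquad \boldsymbol{P}_{\bar z}=\boldsymbol{P}_{\bar y}\,\boldsymbol{P},\qquad \boldsymbol{Q}_y=-\boldsymbol{Q}\,\boldsymbol{Q}_z,\qquad \boldsymbol{Q}_{\bar z}=\boldsymbol{Q}\,\boldsymbol{Q}_{\bar y},$$ where $\boldsymbol{Q}$ is invertible and such that $\sigma(\boldsymbol{P})\cap\sigma(\boldsymbol{Q})=\emptyset$ (at every point). Let $\boldsymbol{X}$ be the unique solution of the Sylvester equation $$\boldsymbol{X}\boldsymbol{P}-\boldsymbol{Q}\boldsymbol{X}=\boldsymbol{V}_0\boldsymbol{U}_0,$$ where $\boldsymbol{U}_0$ is a constant $m\times n$ and $\boldsymbol{V}_0$ a constant $n\times m$ matrix. Then, except at singular points, $$\phi=\phi_0+\boldsymbol{U}_0\boldsymbol{X}^{-1}\boldsymbol{V}_0$$ solves $$\phi_{z\bar z}+\phi_{y\bar y}+[\phi_z,\phi_{\bar y}]=0,$$ and $$g=\big(I+\boldsymbol{U}_0(\boldsymbol{Q}\boldsymbol{X})^{-1}\boldsymbol{V}_0\big)\,g_0$$ solves $$(g_{\bar z}\,g^{-1})_z+(g_y\,g^{-1})_{\bar y}=0 .$$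
   Context: All matrices have entries that are smooth complex functions of four (real or complex) independent variables $y,\bar y,z,\bar z$ (on an open domain); subscripts denote partial derivatives; "constant" means independent of $y,\bar y,z,\bar z$. $\sigma(\cdot)$ denotes the spectrum of a matrix and $I$ is the $m\times m$ identity matrix. "Except at singular points" means: the equation for $\phi$ holds on the open set where $\boldsymbol{X}$ is invertible, and the equation for $g$ on the open set where $\boldsymbol{X}$ and $g$ are invertible. The two equations for $\phi$ and $g$ are two potential forms of the self-dual Yang–Mills equation. *)

theory Defs
  imports "HOL-Analysis.Analysis"
begin

text \<open>
  The coordinates may be real or complex. The class below has exactly these two cases as models
  (up to isomorphism): a subfield of the complex numbers that contains the reals.
\<close>

class real_or_complex = real_normed_field +
  fixes to_complex :: "'a \<Rightarrow> complex"
  assumes to_complex_add: "to_complex (a + b) = to_complex a + to_complex b"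
    and to_complex_mult: "to_complex (a * b) = to_complex a * to_complex b"
    and to_complex_scaleR: "to_complex (r *\<^sub>R a) = r *\<^sub>R to_complex a"
    and norm_to_complex: "norm (to_complex a) = norm a"

instantiation real :: real_or_complex
begin

definition to_complex_real :: "real \<Rightarrow> complex"
  where "to_complex_real = complex_of_real"

instance
  by standard (auto simp: to_complex_real_def scaleR_conv_of_real)

end

instantiation complex :: real_or_complex
begin

definition to_complex_complex :: "complex \<Rightarrow> complex"
  where "to_complex_complex z = z"

instance
  by standard (auto simp: to_complex_complex_def)

end

datatype coord = Y | Ybar | Z | Zbar

instance coord :: finite
proof
  have "(UNIV :: coord set) = {Y, Ybar, Z, Zbar}"
    by (auto intro: coord.exhaust)
  then show "finite (UNIV :: coord set)"
    by (metis finite.emptyI finite_insert)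
qed

definition has_partial ::
    "('k::real_or_complex ^ coord \<Rightarrow> complex) \<Rightarrow> coord \<Rightarrow> complex \<Rightarrow> 'k ^ coord \<Rightarrow> bool"
  where "has_partial f c d p \<longleftrightarrow>
    ((\<lambda>t. f (p + axis c t)) has_derivative (\<lambda>t. to_complex t * d)) (at 0)"

text \<open>In the two cases this is the usual partial derivative, real or holomorphic.\<close>

lemma has_partial_real_iff:
  "has_partial (f :: real ^ coord \<Rightarrow> complex) c d p \<longleftrightarrow>
    ((\<lambda>t. f (p + axis c t)) has_vector_derivative d) (at 0)"
  by (simp add: has_partial_def has_vector_derivative_def to_complex_real_def scaleR_conv_of_real)

lemma has_partial_complex_iff:
  "has_partial (f :: complex ^ coord \<Rightarrow> complex) c d p \<longleftrightarrow>
    ((\<lambda>t. f (p + axis c t)) has_field_derivative d) (at 0)"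
proof -
  have "(\<lambda>t. to_complex t * d) = (*) d"
    by (auto simp: to_complex_complex_def)
  then show ?thesis
    by (simp add: has_partial_def has_field_derivative_def)
qed

definition partial ::
    "coord \<Rightarrow> ('k::real_or_complex ^ coord \<Rightarrow> complex) \<Rightarrow> 'k ^ coord \<Rightarrow> complex"
  where "partial c f p = (THE d. has_partial f c d p)"

primrec Ck_on :: "nat \<Rightarrow> ('k::real_or_complex ^ coord) set \<Rightarrow> ('k ^ coord \<Rightarrow> complex) \<Rightarrow> bool"
  where
    "Ck_on 0 D f \<longleftrightarrow> continuous_on D f"
  | "Ck_on (Suc k) D f \<longleftrightarrow> continuous_on D f \<and>
      (\<forall>c. (\<forall>p\<in>D. \<exists>d. has_partial f c d p) \<and> Ck_on k D (partial c f))"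

text \<open>Meant for open domains. For complex coordinates this says that the function is holomorphic.\<close>

definition smooth_fun_on :: "('k::real_or_complex ^ coord) set \<Rightarrow> ('k ^ coord \<Rightarrow> complex) \<Rightarrow> bool"
  where "smooth_fun_on D f \<longleftrightarrow> (\<forall>k. Ck_on k D f)"

definition smooth_mat_on ::
    "('k::real_or_complex ^ coord) set \<Rightarrow> ('k ^ coord \<Rightarrow> complex ^ 'b ^ 'a) \<Rightarrow> bool"
  where "smooth_mat_on D F \<longleftrightarrow> (\<forall>i j. smooth_fun_on D (\<lambda>p. F p $ i $ j))"

definition mat_partial ::
    "coord \<Rightarrow> ('k::real_or_complex ^ coord \<Rightarrow> complex ^ 'b ^ 'a) \<Rightarrow> 'k ^ coord \<Rightarrow> complex ^ 'b ^ 'a"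
  where "mat_partial c F p = (\<chi> i j. partial c (\<lambda>q. F q $ i $ j) p)"

definition mat_spectrum :: "complex ^ 'n ^ 'n \<Rightarrow> complex set"
  where "mat_spectrum A = {l. \<exists>v. v \<noteq> 0 \<and> A *v v = l *s v}"

definition commutator :: "complex ^ 'm ^ 'm \<Rightarrow> complex ^ 'm ^ 'm \<Rightarrow> complex ^ 'm ^ 'm"
  where "commutator A B = A ** B - B ** A"

text \<open>
  The subscripts of \<open>\<phi>\<close> are read from left to right: in the first term \<open>Z\<close>, then \<open>Zbar\<close>.
  On an open domain the order is immaterial for smooth functions.
\<close>

definition solves_phi_eq_on ::
    "('k::real_or_complex ^ coord) set \<Rightarrow> ('k ^ coord \<Rightarrow> complex ^ 'm ^ 'm) \<Rightarrow> bool"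
  where "solves_phi_eq_on D \<phi> \<longleftrightarrow> open D \<and> smooth_mat_on D \<phi> \<and>
    (\<forall>p\<in>D. mat_partial Zbar (mat_partial Z \<phi>) p + mat_partial Ybar (mat_partial Y \<phi>) p
      + commutator (mat_partial Z \<phi> p) (mat_partial Ybar \<phi> p) = 0)"

definition solves_g_eq_on ::
    "('k::real_or_complex ^ coord) set \<Rightarrow> ('k ^ coord \<Rightarrow> complex ^ 'm ^ 'm) \<Rightarrow> bool"
  where "solves_g_eq_on D g \<longleftrightarrow> open D \<and> smooth_mat_on D g \<and> (\<forall>p\<in>D. invertible (g p)) \<and>
    (\<forall>p\<in>D. mat_partial Z (\<lambda>q. mat_partial Zbar g q ** matrix_inv (g q)) p
      + mat_partial Ybar (\<lambda>q. mat_partial Y g q ** matrix_inv (g q)) p = 0)"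

end

theory Submission
  imports Defs "HOL-Computational_Algebra.Fundamental_Theorem_Algebra"
begin

text \<open>
  Differentiating the Sylvester equation and using the Riemann equations for \<open>P\<close> and \<open>Q\<close>, one sees
  that each of the pairs \<open>X_y\<close>, \<open>Q_z X - X_z P\<close> and \<open>X_zbar\<close>, \<open>X_ybar P - Q_ybar X\<close> solves one
  and the same Sylvester equation, so that its members agree. Together with
  \<open>P X^-1 - X^-1 Q = X^-1 V0 U0 X^-1\<close> this gives \<open>g_zbar = \<phi>_ybar g\<close> and \<open>g_y = - \<phi>_z g\<close>, and the
  equation for \<open>g\<close> says that the mixed derivatives of \<open>\<phi>\<close> commute. The equation for \<open>\<phi>\<close> must also
  hold where \<open>g\<close> is singular, so it is checked directly from the same relations.
\<close>

subsection \<open>Matrix polynomials and the Sylvester equation\<close>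

text \<open>\<open>X\<close> is given only pointwise, by a linear equation at each point, so its
  smoothness has to be established before anything can be differentiated. Injectivity of the
  Sylvester operator therefore serves twice: it makes the linear system for the entries of
  \<open>X\<close> solvable by Cramer's rule with smooth coefficients, and it identifies the pairs
  of derivatives. Injectivity itself rests on some nonzero polynomial annihilating \<open>P\<close>,
  whose roots are stripped off one at a time; no normal form of matrices enters. Real and complex
  coordinates are treated together. Sum, product and quotient rules do not distinguish them; only
  the symmetry of mixed derivatives is reduced to real calculus, on a real plane through the given
  point.\<close>

lemma matrix_add_rdistrib: "(B + C) ** A = B ** A + C ** A"
  by (simp add: matrix_matrix_mult_def vec_eq_iff distrib_right sum.distrib)

lemma matrix_minus_left: "(- B) ** A = - (B ** A)"
  for A :: "'a::ring_1 ^ 'n ^ 'm"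
  by (simp add: matrix_matrix_mult_def vec_eq_iff sum_negf)

lemma matrix_minus_right: "B ** (- A) = - (B ** A)"
  for A :: "'a::ring_1 ^ 'n ^ 'm"
  by (simp add: matrix_matrix_mult_def vec_eq_iff sum_negf)

lemma matrix_diff_ldistrib: "A ** (B - C) = A ** B - A ** C"
  for A :: "'a::ring_1 ^ 'n ^ 'm"
  by (simp add: matrix_matrix_mult_def vec_eq_iff right_diff_distrib sum_subtractf)

lemma matrix_diff_rdistrib: "(B - C) ** A = B ** A - C ** A"
  for A :: "'a::ring_1 ^ 'n ^ 'm"
  by (simp add: matrix_matrix_mult_def vec_eq_iff left_diff_distrib sum_subtractf)

lemmas matrix_ring = matrix_add_ldistrib matrix_add_rdistrib matrix_minus_left
  matrix_minus_right matrix_diff_ldistrib matrix_diff_rdistrib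

lemma matrix_inv_right: "invertible A \<Longrightarrow> A ** matrix_inv A = mat 1"
  and matrix_inv_left: "invertible A \<Longrightarrow> matrix_inv A ** A = mat 1"
  unfolding invertible_def matrix_inv_def by (rule someI2_ex, auto)+

lemma matrix_inv_mult:
  fixes A B :: "'a::field ^ 'n ^ 'n"
  assumes "invertible A" "invertible B"
  shows "matrix_inv (A ** B) = matrix_inv B ** matrix_inv A"
proof -
  have "(A ** B) ** (matrix_inv B ** matrix_inv A) = A ** (B ** matrix_inv B) ** matrix_inv A"
    by (simp only: matrix_mul_assoc)
  then have "(A ** B) ** (matrix_inv B ** matrix_inv A) = mat 1"
    using assms by (simp add: matrix_inv_right)
  then show ?thesis
    by (metis matrix_inv_left[OF invertible_mult[OF assms]] matrix_mul_assoc matrix_mul_lid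
        matrix_mul_rid)
qed

section \<open>Scalar matrices and polynomials in a square matrix\<close>

lemma mat_mult_nth: "(mat c ** A) $ i $ j = c * A $ i $ j"
  by (simp add: matrix_matrix_mult_def mat_def if_distrib[of "\<lambda>x. x * _"] cong: if_cong)

lemma mult_mat_nth: "(A ** mat c) $ i $ j = A $ i $ j * c"
  by (simp add: matrix_matrix_mult_def mat_def if_distrib[of "\<lambda>x. _ * x"] cong: if_cong)

lemma mat_mult_commute: "A ** mat c = mat c ** A"
  for A :: "'a::comm_semiring_1 ^ 'n ^ 'n"
  by (simp add: vec_eq_iff mat_mult_nth mult_mat_nth mult.commute)

lemma mat_mult: "mat (c * d) = mat c ** mat d"
  by (simp add: vec_eq_iff mat_mult_nth) (simp add: mat_def)

lemma mat_add: "mat (c + d) = mat c + (mat d :: 'a::semiring_1 ^ 'n ^ 'n)"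
  by (simp add: mat_def vec_eq_iff)

lemma mat_minus: "mat (- c) = - (mat c :: 'a::ring_1 ^ 'n ^ 'n)"
  by (simp add: mat_def vec_eq_iff)

text \<open>Horner's scheme for the matrix product \<open>**\<close>. That product is not the
  multiplication \<open>*\<close> of the type, so \<open>poly\<close> cannot serve.\<close>

definition mat_poly :: "complex poly \<Rightarrow> complex ^ 'n ^ 'n \<Rightarrow> complex ^ 'n ^ 'n"
  where "mat_poly p A = fold_coeffs (\<lambda>a M. mat a + A ** M) p 0"

lemma mat_poly_0 [simp]: "mat_poly 0 A = 0"
  by (simp add: mat_poly_def)

lemma mat_poly_pCons [simp]: "mat_poly (pCons a p) A = mat a + A ** mat_poly p A"
  by (cases "p = 0"; cases "a = 0") (simp_all add: mat_poly_def)

lemma mat_poly_add: "mat_poly (p + q) A = mat_poly p A + mat_poly q A"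
proof (induction p arbitrary: q)
  case (pCons a p)
  then show ?case
    by (cases q) (simp add: mat_add matrix_add_ldistrib)
qed simp

lemma mat_poly_smult: "mat_poly (smult c p) A = mat c ** mat_poly p A"
  by (induction p)
    (simp_all add: mat_mult matrix_add_ldistrib matrix_mul_assoc mat_mult_commute[of A c])

lemma mat_poly_linear_mult:
  "mat_poly ([:- l, 1:] * q) A = (A - mat l) ** mat_poly q A"
  using mat_poly_add[of "smult (- l) q" "pCons 0 q" A] mat_poly_smult[of "- l" q A]
  by (simp add: mat_minus matrix_ring)

lemma mat_poly_monom: "mat_poly (monom c k) A = mat c ** (((**) A) ^^ k) (mat 1)"
  by (induction k) (simp_all add: monom_0 monom_Suc matrix_mul_assoc mat_mult_commute[of A c])

lemma mat_poly_sum: "mat_poly (\<Sum>k\<in>K. f k) A = (\<Sum>k\<in>K. mat_poly (f k) A)"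
  by (induction K rule: infinite_finite_induct) (simp_all add: mat_poly_add)

text \<open>N + 1 powers of \<open>A\<close> in a space of dimension N are linearly dependent, and a
  dependency is the polynomial sought. For stripping off roots it need not be the characteristic or
  the minimal polynomial.\<close>

lemma annihilating_poly:
  fixes A :: "complex ^ 'n ^ 'n"
  obtains p where "p \<noteq> 0" "mat_poly p A = 0"
proof -
  \<comment> \<open>The real dimension, so the relation between the powers has real
    coefficients.\<close>
  define N where "N = DIM(complex ^ 'n ^ 'n)"
  define pw where "pw k = (((**) A) ^^ k) (mat 1)" for k
  have ev: "mat_poly (\<Sum>k\<le>N. monom (complex_of_real (c k)) k) A = (\<Sum>k\<le>N. c k *\<^sub>R pw k)" for c
  proof -
    have "mat (complex_of_real r) ** M = r *\<^sub>R M" for r and M :: "complex ^ 'n ^ 'n"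
      by (simp add: vec_eq_iff mat_mult_nth) (simp add: scaleR_conv_of_real)
    then show ?thesis
      by (simp add: mat_poly_sum mat_poly_monom pw_def)
  qed
  have nz: "(\<Sum>k\<le>N. monom (complex_of_real (c k)) k) \<noteq> 0" if "j \<le> N" "c j \<noteq> 0" for c j
  proof
    assume "(\<Sum>k\<le>N. monom (complex_of_real (c k)) k) = 0"
    then have "coeff (\<Sum>k\<le>N. monom (complex_of_real (c k)) k) j = 0"
      by simp
    then show False
      using that by (simp add: coeff_sum if_distrib cong: if_cong)
  qed
  have "\<exists>c. (\<exists>j\<le>N. c j \<noteq> 0) \<and> (\<Sum>k\<le>N. c k *\<^sub>R pw k) = 0"
  \<comment> \<open>Linear dependence is a property of sets and does not see repetitions; if two
    powers coincide, their difference is already a relation.\<close>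
  proof (cases "inj_on pw {..N}")
    case True
    then have "card (pw ` {..N}) > DIM(complex ^ 'n ^ 'n)"
      by (simp add: card_image N_def)
    then have "dependent (pw ` {..N})"
      by (rule dependent_biggerset)
    then obtain u where u: "\<exists>v\<in>pw ` {..N}. u v \<noteq> 0" "(\<Sum>v\<in>pw ` {..N}. u v *\<^sub>R v) = 0"
      by (auto simp: dependent_finite)
    then show ?thesis
      using True by (intro exI[of _ "\<lambda>k. u (pw k)"]) (auto simp: sum.reindex)
  next
    case False
    then obtain i j where ij: "i \<le> N" "j \<le> N" "i \<noteq> j" "pw i = pw j"
      by (auto simp: inj_on_def)
    have "(\<Sum>k\<le>N. (of_bool (k = i) - of_bool (k = j)) *\<^sub>R pw k) = 0"
      using ij by (simp add: scaleR_diff_left sum_subtractf of_bool_def if_distribR[of _ _ _ "pw _"]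
          if_distrib[of "\<lambda>r. r *\<^sub>R pw _"] cong: if_cong)
    then show ?thesis
      using ij by (intro exI[of _ "\<lambda>k. of_bool (k = i) - of_bool (k = j)"]) auto
  qed
  then show thesis
    using that ev nz by metis
qed

lemma invertible_minus_mat:
  fixes A :: "complex ^ 'n ^ 'n"
  assumes "l \<notin> mat_spectrum A"
  shows "invertible (A - mat l)"
proof -
  have "mat l *v v = l *s v" for v :: "complex ^ 'n"
    by (simp add: matrix_vector_mult_def mat_def vec_eq_iff if_distrib if_distribR cong: if_cong)
  then have "(A - mat l) *v v = 0 \<Longrightarrow> v = 0" for v
    using assms by (auto simp: mat_spectrum_def matrix_vector_mult_diff_rdistrib)
  then show ?thesis
    by (metis invertible_left_inverse matrix_left_invertible_ker)
qed

text \<open>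
  If \<open>S\<close> intertwines \<open>P\<close> and \<open>Q\<close>, then so does \<open>S (P - l) = (Q - l) S\<close>; this removes the roots of
  \<open>p\<close> one at a time, since \<open>P - l\<close> or \<open>Q - l\<close> is invertible.
\<close>

lemma intertwiner_eq_0_aux:
  fixes P Q S :: "complex ^ 'n ^ 'n"
  assumes disj: "mat_spectrum P \<inter> mat_spectrum Q = {}"
    and "p \<noteq> 0" "S ** mat_poly p P = 0" "S ** P = Q ** S"
  shows "S = 0"
  using assms(2-4)
proof (induction "degree p" arbitrary: p S)
  case 0
  \<comment> \<open>A nonzero constant polynomial evaluates to an invertible scalar matrix, so
    \<open>S\<close> itself vanishes.\<close>
  then obtain c where c: "p = [:c:]" "c \<noteq> 0"
    by (metis pCons_0_0 degree_eq_zeroE)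
  then have "S ** mat c ** mat (1 / c) = 0"
    using 0 by simp
  then show ?case
    using c by (simp add: matrix_mul_assoc[symmetric] mat_mult[symmetric])
next
  case (Suc d)
  then have "\<not> constant (poly p)"
    by (simp add: constant_degree)
  then obtain l where "poly p l = 0"
    using fundamental_theorem_of_algebra by blast
  then obtain q where q: "p = [:- l, 1:] * q"
    by (auto simp: poly_eq_0_iff_dvd)
  with Suc have "q \<noteq> 0"
    by auto
  then have "degree p = Suc (degree q)"
    unfolding q by (subst degree_mult_eq) auto
  then have "d = degree q"
    using Suc by simp
  have T: "S ** (P - mat l) = (Q - mat l) ** S"
    using Suc.prems by (simp add: matrix_ring mat_mult_commute)
  have "S ** (P - mat l) ** P = Q ** (S ** (P - mat l))"
    using Suc.prems(3) unfolding matrix_diff_ldistrib matrix_diff_rdistrib mat_mult_commute[of S l]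
    by (metis matrix_mul_assoc mat_mult_commute)
  \<comment> \<open>The linear factor moves from the polynomial into the intertwiner, leaving
    \<open>q\<close>, of degree one less.\<close>
  moreover have "S ** (P - mat l) ** mat_poly q P = 0"
    using Suc.prems(2) unfolding q mat_poly_linear_mult by (simp add: matrix_mul_assoc)
  ultimately have 0: "S ** (P - mat l) = 0"
    using Suc.hyps(1)[OF \<open>d = degree q\<close> \<open>q \<noteq> 0\<close>] by blast
  show ?case
  proof (cases "l \<in> mat_spectrum P")
    case False
    then show ?thesis
      using 0 by (metis invertible_minus_mat invertible_def matrix_mul_assoc matrix_mul_rid
          times0_left)
  next
    case True
    then have "l \<notin> mat_spectrum Q"
      using disj by auto
    then show ?thesis
      using 0 T by (metis invertible_minus_mat invertible_def matrix_mul_assoc matrix_mul_lid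
          times0_right)
  qed
qed

lemma intertwiner_eq_0:
  fixes P Q S :: "complex ^ 'n ^ 'n"
  assumes "mat_spectrum P \<inter> mat_spectrum Q = {}" "S ** P = Q ** S"
  shows "S = 0"
proof -
  obtain p where "p \<noteq> 0" "mat_poly p P = 0"
    using annihilating_poly by blast
  then show ?thesis
    using intertwiner_eq_0_aux[OF assms(1)] assms(2) by simp
qed

lemma sylvester_unique:
  fixes P Q S T :: "complex ^ 'n ^ 'n"
  assumes "mat_spectrum P \<inter> mat_spectrum Q = {}" "S ** P - Q ** S = T ** P - Q ** T"
  shows "S = T"
proof -
  have "(S - T) ** P - Q ** (S - T) = 0"
    using assms(2) unfolding matrix_diff_ldistrib matrix_diff_rdistrib
    by (simp add: algebra_simps)
  then show ?thesis
    using intertwiner_eq_0[OF assms(1), of "S - T"] by simp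
qed

subsection \<open>Smooth functions and commuting partial derivatives\<close>

text \<open>The image of 1 is an idempotent of norm 1 in a field, hence nonzero and equal to
  1.\<close>

lemma to_complex_1 [simp]: "to_complex 1 = 1"
proof -
  have "to_complex (1::'a) \<noteq> 0"
    using norm_to_complex[of "1::'a"] by auto
  moreover have "to_complex (1::'a) * to_complex (1::'a) = to_complex (1::'a)"
    using to_complex_mult[of "1::'a" 1] by simp
  ultimately show ?thesis
    by simp
qed

lemma to_complex_of_real: "to_complex (of_real r) = of_real r"
  by (simp add: of_real_def to_complex_scaleR)

lemma axis_add: "axis c (s + t) = axis c s + axis c (t :: 'a::monoid_add)"
  by (simp add: axis_def vec_eq_iff)

lemma axis_0 [simp]: "axis c 0 = 0"
  by (simp add: axis_def vec_eq_iff)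

lemma tendsto_axis: "((\<lambda>t. p + axis c (t :: 'a::real_normed_vector)) \<longlongrightarrow> p + axis c t) (at t within T)"
proof -
  have "((\<lambda>t. \<chi> i. p $ i + (if i = c then t else 0)) \<longlongrightarrow> (\<chi> i. p $ i + (if i = c then t else 0)))
      (at t within T)"
    by (intro tendsto_vec_lambda) (auto intro!: tendsto_intros)
  moreover have "(\<lambda>t. \<chi> i. p $ i + (if i = c then t else 0)) = (\<lambda>t. p + axis c t)"
    by (simp add: axis_def vec_eq_iff fun_eq_iff)
  ultimately show ?thesis
    by metis
qed

text \<open>A derivative along an axis sees only increments near 0; this supplies the neighbourhood
  of increments that stay in \<open>D\<close>.\<close>

lemma open_line_vimage:
  assumes "open D"
  shows "open {t :: 'a::real_normed_vector. p + axis c t \<in> D}"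
proof -
  have "continuous_on UNIV (\<lambda>t :: 'a. p + axis c t)"
    by (simp add: continuous_on_def tendsto_axis)
  then show ?thesis
    using assms by (simp add: continuous_on_open_vimage vimage_def)
qed

lemma has_partial_cong:
  assumes "open D" "p \<in> D" "\<And>q. q \<in> D \<Longrightarrow> f q = g q" "has_partial f c d p"
  shows "has_partial g c d p"
  unfolding has_partial_def
proof (rule has_derivative_transform_within_open)
  show "((\<lambda>t. f (p + axis c t)) has_derivative (\<lambda>t. to_complex t * d)) (at 0)"
    using assms(4) by (simp add: has_partial_def)
  show "open {t. p + axis c t \<in> D}"
    by (rule open_line_vimage[OF assms(1)])
qed (use assms in auto)

text \<open>The derivative is unique as a linear map, and its value at 1 recovers the
  coefficient.\<close>

lemma has_partial_unique: "has_partial f c d p \<Longrightarrow> has_partial f c d' p \<Longrightarrow> d = d'"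
  unfolding has_partial_def by (drule (1) has_derivative_unique) (metis mult_1 to_complex_1)

lemma partial_eqI: "has_partial f c d p \<Longrightarrow> partial c f p = d"
  unfolding partial_def by (blast intro: has_partial_unique)

lemma partial_cong:
  assumes "open D" "p \<in> D" "\<And>q. q \<in> D \<Longrightarrow> f q = g q"
  shows "partial c f p = partial c g p"
proof -
  have "has_partial f c d p \<longleftrightarrow> has_partial g c d p" for d
    using has_partial_cong[OF assms(1,2), of f g] has_partial_cong[OF assms(1,2), of g f] assms(3)
    by metis
  then show ?thesis
    by (simp add: partial_def)
qed

lemma has_partial_const: "has_partial (\<lambda>q. a) c 0 p"
  by (simp add: has_partial_def)

lemma has_partial_add:
  "has_partial f c d p \<Longrightarrow> has_partial g c e p \<Longrightarrow> has_partial (\<lambda>q. f q + g q) c (d + e) p"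
  unfolding has_partial_def distrib_left by (rule has_derivative_add)

lemma has_partial_mult:
  assumes "has_partial f c d p" "has_partial g c e p"
  shows "has_partial (\<lambda>q. f q * g q) c (d * g p + f p * e) p"
  using has_derivative_mult[OF assms[unfolded has_partial_def]]
  unfolding has_partial_def by (simp add: algebra_simps)

lemma has_partial_inverse:
  assumes "has_partial f c d p" "f p \<noteq> 0"
  shows "has_partial (\<lambda>q. inverse (f q)) c (- d * (inverse (f p) * inverse (f p))) p"
  using Deriv.has_derivative_inverse[OF _ assms(1)[unfolded has_partial_def]] assms(2)
  unfolding has_partial_def by (simp add: algebra_simps)

section \<open>Closure properties of \<open>Ck_on\<close>\<close>

lemma Ck_on_has_partial:
  assumes "Ck_on (Suc k) D f" "p \<in> D"
  shows "has_partial f c (partial c f p) p"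
proof -
  obtain d where "has_partial f c d p"
    using assms by auto
  then show ?thesis
    using partial_eqI by metis
qed

lemma Ck_on_continuous: "Ck_on k D f \<Longrightarrow> continuous_on D f"
  by (cases k) auto

lemma Ck_on_Suc_imp: "Ck_on (Suc k) D f \<Longrightarrow> Ck_on k D f"
  by (induction k arbitrary: f) auto

lemma Ck_on_subset: "Ck_on k D f \<Longrightarrow> E \<subseteq> D \<Longrightarrow> Ck_on k E f"
  by (induction k arbitrary: f) (auto intro: continuous_on_subset)

text \<open>As \<open>D\<close> is open, the partial derivatives of \<open>f\<close> and
  \<open>g\<close> agree on \<open>D\<close> as well, so the induction passes the equality on to
  them.\<close>

lemma Ck_on_cong:
  assumes "open D" "\<And>q. q \<in> D \<Longrightarrow> f q = g q" "Ck_on k D f"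
  shows "Ck_on k D g"
  using assms(2,3)
proof (induction k arbitrary: f g)
  case 0
  then show ?case
    by (metis Ck_on.simps(1) continuous_on_cong)
next
  case (Suc k)
  have "continuous_on D g"
    using Suc.prems by (metis Ck_on_continuous continuous_on_cong)
  moreover have "has_partial g c (partial c f p) p" if "p \<in> D" for c p
    by (rule has_partial_cong[OF assms(1) that Suc.prems(1) Ck_on_has_partial[OF Suc.prems(2) that]])
  moreover have "Ck_on k D (partial c g)" for c
  proof (rule Suc.IH)
    show "partial c f q = partial c g q" if "q \<in> D" for q
      by (rule partial_cong[OF assms(1) that Suc.prems(1)])
  qed (use Suc.prems in auto)
  ultimately show ?case
    by auto
qed

text \<open>Replaces the definite description \<open>partial c f\<close> by an explicit formula
  \<open>f'\<close> that needs to be a derivative on \<open>D\<close> only.\<close>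

lemma Ck_on_SucI:
  assumes "open D" "continuous_on D f" "\<And>c p. p \<in> D \<Longrightarrow> has_partial f c (f' c p) p"
    "\<And>c. Ck_on k D (f' c)"
  shows "Ck_on (Suc k) D f"
proof -
  have "Ck_on k D (partial c f)" for c
    by (rule Ck_on_cong[OF assms(1) _ assms(4)]) (rule partial_eqI[OF assms(3), symmetric])
  then show ?thesis
    using assms by auto
qed

lemma Ck_on_const: "open D \<Longrightarrow> Ck_on k D (\<lambda>q. a)"
proof (induction k arbitrary: a)
  case (Suc k)
  then show ?case
    by (intro Ck_on_SucI[of _ _ "\<lambda>_ _. 0"]) (auto intro: has_partial_const)
qed simp

lemma Ck_on_add: "open D \<Longrightarrow> Ck_on k D f \<Longrightarrow> Ck_on k D g \<Longrightarrow> Ck_on k D (\<lambda>q. f q + g q)"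
proof (induction k arbitrary: f g)
  case (Suc k)
  show ?case
  proof (rule Ck_on_SucI[of _ _ "\<lambda>c p. partial c f p + partial c g p"])
    show "Ck_on k D (\<lambda>p. partial c f p + partial c g p)" for c
      using Suc by auto
  qed (use Suc Ck_on_has_partial in \<open>blast intro: continuous_on_add Ck_on_continuous has_partial_add\<close>)+
qed (auto intro: continuous_on_add)

lemma Ck_on_mult: "open D \<Longrightarrow> Ck_on k D f \<Longrightarrow> Ck_on k D g \<Longrightarrow> Ck_on k D (\<lambda>q. f q * g q)"
proof (induction k arbitrary: f g)
  case (Suc k)
  show ?case
  proof (rule Ck_on_SucI[of _ _ "\<lambda>c p. partial c f p * g p + f p * partial c g p"])
    show "Ck_on k D (\<lambda>p. partial c f p * g p + f p * partial c g p)" for c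
      \<comment> \<open>The product rule also contains \<open>f\<close> and \<open>g\<close>
        undifferentiated, so both are needed one order lower.\<close>
      using Suc.prems Suc.IH Ck_on_Suc_imp[of k D f] Ck_on_Suc_imp[of k D g]
      by (intro Ck_on_add) auto
  qed (use Suc Ck_on_has_partial in \<open>blast intro: continuous_on_mult Ck_on_continuous has_partial_mult\<close>)+
qed (auto intro: continuous_on_mult)

text \<open>The derivative of the reciprocal contains only the reciprocal itself, covered by the
  induction hypothesis, and a derivative of \<open>f\<close>.\<close>

lemma Ck_on_inverse:
  assumes "open D" "\<And>p. p \<in> D \<Longrightarrow> f p \<noteq> 0" "Ck_on k D f"
  shows "Ck_on k D (\<lambda>q. inverse (f q))"
  using assms(3)
proof (induction k)
  case 0
  then show ?case
    using assms(2) by (auto intro: continuous_on_inverse)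
next
  case (Suc k)
  show ?case
  \<comment> \<open>The sign is written as a factor \<open>- 1\<close>, so that closure under
    products and constants is enough.\<close>
  proof (rule Ck_on_SucI[OF assms(1), of _ "\<lambda>c p. - 1 * partial c f p * (inverse (f p) * inverse (f p))"])
    show "continuous_on D (\<lambda>q. inverse (f q))"
      using Suc.prems assms(2) by (auto intro: continuous_on_inverse)
    show "has_partial (\<lambda>q. inverse (f q)) c (- 1 * partial c f p * (inverse (f p) * inverse (f p))) p"
      if "p \<in> D" for c p
      using has_partial_inverse[OF Ck_on_has_partial[OF Suc.prems that] assms(2)[OF that]] by simp
    show "Ck_on k D (\<lambda>p. - 1 * partial c f p * (inverse (f p) * inverse (f p)))" for c
      using Suc.IH[OF Ck_on_Suc_imp[OF Suc.prems]] Suc.prems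
      by (intro Ck_on_mult assms Ck_on_const) auto
  qed
qed

lemma smooth_fun_on_subset: "smooth_fun_on D f \<Longrightarrow> E \<subseteq> D \<Longrightarrow> smooth_fun_on E f"
  by (auto simp: smooth_fun_on_def intro: Ck_on_subset)

lemma smooth_fun_on_cong:
  "open D \<Longrightarrow> (\<And>q. q \<in> D \<Longrightarrow> f q = g q) \<Longrightarrow> smooth_fun_on D f \<Longrightarrow> smooth_fun_on D g"
  unfolding smooth_fun_on_def using Ck_on_cong by blast

lemma smooth_fun_on_has_partial:
  "smooth_fun_on D f \<Longrightarrow> p \<in> D \<Longrightarrow> has_partial f c (partial c f p) p"
  unfolding smooth_fun_on_def using Ck_on_has_partial by blast

lemma smooth_fun_on_partial: "smooth_fun_on D f \<Longrightarrow> smooth_fun_on D (partial c f)"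
  unfolding smooth_fun_on_def by (metis Ck_on.simps(2))

lemma smooth_fun_on_const: "open D \<Longrightarrow> smooth_fun_on D (\<lambda>q. a)"
  by (simp add: smooth_fun_on_def Ck_on_const)

lemma smooth_fun_on_add:
  "open D \<Longrightarrow> smooth_fun_on D f \<Longrightarrow> smooth_fun_on D g \<Longrightarrow> smooth_fun_on D (\<lambda>q. f q + g q)"
  by (simp add: smooth_fun_on_def Ck_on_add)

lemma smooth_fun_on_mult:
  "open D \<Longrightarrow> smooth_fun_on D f \<Longrightarrow> smooth_fun_on D g \<Longrightarrow> smooth_fun_on D (\<lambda>q. f q * g q)"
  by (simp add: smooth_fun_on_def Ck_on_mult)

lemma smooth_fun_on_minus: "open D \<Longrightarrow> smooth_fun_on D f \<Longrightarrow> smooth_fun_on D (\<lambda>q. - f q)"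
  using smooth_fun_on_mult[OF _ smooth_fun_on_const[of _ "-1"]] by fastforce

lemma smooth_fun_on_diff:
  "open D \<Longrightarrow> smooth_fun_on D f \<Longrightarrow> smooth_fun_on D g \<Longrightarrow> smooth_fun_on D (\<lambda>q. f q - g q)"
  using smooth_fun_on_add[OF _ _ smooth_fun_on_minus] by fastforce

lemma smooth_fun_on_if:
  "smooth_fun_on D f \<Longrightarrow> smooth_fun_on D g \<Longrightarrow> smooth_fun_on D (\<lambda>q. if b then f q else g q)"
  by (cases b) simp_all

lemma smooth_fun_on_divide:
  assumes "open D" "smooth_fun_on D f" "smooth_fun_on D g" "\<And>p. p \<in> D \<Longrightarrow> g p \<noteq> 0"
  shows "smooth_fun_on D (\<lambda>q. f q / g q)"
  unfolding divide_inverse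
  using assms by (intro smooth_fun_on_mult) (simp_all add: smooth_fun_on_def Ck_on_inverse)

lemma smooth_fun_on_sum:
  "open D \<Longrightarrow> (\<And>i. i \<in> I \<Longrightarrow> smooth_fun_on D (f i)) \<Longrightarrow> smooth_fun_on D (\<lambda>q. \<Sum>i\<in>I. f i q)"
  by (induction I rule: infinite_finite_induct) (auto intro: smooth_fun_on_const smooth_fun_on_add)

lemma smooth_fun_on_prod:
  "open D \<Longrightarrow> (\<And>i. i \<in> I \<Longrightarrow> smooth_fun_on D (f i)) \<Longrightarrow> smooth_fun_on D (\<lambda>q. \<Prod>i\<in>I. f i q)"
  by (induction I rule: infinite_finite_induct) (auto intro: smooth_fun_on_const smooth_fun_on_mult)

lemma smooth_fun_on_det:
  assumes "open D" "\<And>i j. smooth_fun_on D (\<lambda>q. A q $ i $ j)"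
  shows "smooth_fun_on D (\<lambda>q. det (A q))"
  unfolding det_def
  by (intro smooth_fun_on_sum smooth_fun_on_mult smooth_fun_on_prod smooth_fun_on_const assms)

section \<open>Symmetry of second partial derivatives\<close>

lemma second_difference_mvt:
  fixes u us ust :: "real \<Rightarrow> real \<Rightarrow> real"
  assumes "h > 0"
    and us: "\<And>s t. 0 \<le> s \<Longrightarrow> s \<le> h \<Longrightarrow> 0 \<le> t \<Longrightarrow> t \<le> h \<Longrightarrow>
      ((\<lambda>s. u s t) has_real_derivative us s t) (at s)"
    and ust: "\<And>s t. 0 \<le> s \<Longrightarrow> s \<le> h \<Longrightarrow> 0 \<le> t \<Longrightarrow> t \<le> h \<Longrightarrow>
      ((\<lambda>t. us s t) has_real_derivative ust s t) (at t)"
  shows "\<exists>\<xi> \<eta>. 0 < \<xi> \<and> \<xi> < h \<and> 0 < \<eta> \<and> \<eta> < h \<and>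
    u h h - u h 0 - u 0 h + u 0 0 = h * h * ust \<xi> \<eta>"
proof -
  \<comment> \<open>The mean value theorem is applied to \<open>u s h - u s 0\<close> as a function
    of \<open>s\<close>, and then to \<open>us\<close> in its second variable.\<close>
  have "\<exists>\<xi>>0. \<xi> < h \<and> (u h h - u h 0) - (u 0 h - u 0 0) = (h - 0) * (us \<xi> h - us \<xi> 0)"
    using assms(1) by (intro MVT2 derivative_intros us) auto
  then obtain \<xi> where \<xi>: "0 < \<xi>" "\<xi> < h"
    "(u h h - u h 0) - (u 0 h - u 0 0) = (h - 0) * (us \<xi> h - us \<xi> 0)"
    by blast
  have "\<exists>\<eta>>0. \<eta> < h \<and> us \<xi> h - us \<xi> 0 = (h - 0) * ust \<xi> \<eta>"
    using assms(1) \<xi> by (intro MVT2 ust) auto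
  then obtain \<eta> where "0 < \<eta>" "\<eta> < h" "us \<xi> h - us \<xi> 0 = (h - 0) * ust \<xi> \<eta>"
    by blast
  with \<xi> show ?thesis
    by (intro exI[of _ \<xi>] exI[of _ \<eta>]) simp
qed

text \<open>The second difference over a square of side h is symmetric in the two variables. It is
  therefore h^2 times a value of \<open>ust\<close> and also h^2 times a value of
  \<open>uts\<close>, at points inside the square. Dividing by h^2 and letting h tend to 0,
  continuity at the origin gives the equality.\<close>

lemma clairaut_real:
  fixes u us ut ust uts :: "real \<Rightarrow> real \<Rightarrow> real"
  assumes "r > 0"
    and us: "\<And>s t. \<bar>s\<bar> < r \<Longrightarrow> \<bar>t\<bar> < r \<Longrightarrow> ((\<lambda>s. u s t) has_real_derivative us s t) (at s)"
    and ut: "\<And>s t. \<bar>s\<bar> < r \<Longrightarrow> \<bar>t\<bar> < r \<Longrightarrow> ((\<lambda>t. u s t) has_real_derivative ut s t) (at t)"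
    and ust: "\<And>s t. \<bar>s\<bar> < r \<Longrightarrow> \<bar>t\<bar> < r \<Longrightarrow> ((\<lambda>t. us s t) has_real_derivative ust s t) (at t)"
    and uts: "\<And>s t. \<bar>s\<bar> < r \<Longrightarrow> \<bar>t\<bar> < r \<Longrightarrow> ((\<lambda>s. ut s t) has_real_derivative uts s t) (at s)"
    and cont: "isCont (\<lambda>x. ust (fst x) (snd x)) (0, 0)" "isCont (\<lambda>x. uts (fst x) (snd x)) (0, 0)"
  shows "ust 0 0 = uts 0 0"
proof -
  \<comment> \<open>The summand 2 gives \<open>h n < r\<close> strictly, even for n = 0, so the
    closed square lies in the open box where the derivatives exist.\<close>
  define h where "h n = r / real (n + 2)" for n
  have h: "0 < h n" "h n < r" for n
    using assms(1) by (auto simp: h_def field_simps add_pos_nonneg)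
  have h0: "h \<longlonglongrightarrow> 0"
    unfolding h_def using LIMSEQ_ignore_initial_segment[OF lim_const_over_n[of r], of 2] by simp
  have "\<exists>\<xi> \<eta>. 0 < \<xi> \<and> \<xi> < h n \<and> 0 < \<eta> \<and> \<eta> < h n \<and>
      u (h n) (h n) - u (h n) 0 - u 0 (h n) + u 0 0 = h n * h n * ust \<xi> \<eta>" for n
    using h[of n] by (intro second_difference_mvt[of "h n" u us] us ust) auto
  then obtain \<xi> \<eta> where 1: "\<And>n. 0 < \<xi> n \<and> \<xi> n < h n \<and> 0 < \<eta> n \<and> \<eta> n < h n \<and>
      u (h n) (h n) - u (h n) 0 - u 0 (h n) + u 0 0 = h n * h n * ust (\<xi> n) (\<eta> n)"
    by metis
  \<comment> \<open>The same second difference with the variables exchanged, hence the swapped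
    arguments of \<open>uts\<close>.\<close>
  have "\<exists>\<xi> \<eta>. 0 < \<xi> \<and> \<xi> < h n \<and> 0 < \<eta> \<and> \<eta> < h n \<and>
      u (h n) (h n) - u 0 (h n) - u (h n) 0 + u 0 0 = h n * h n * uts \<eta> \<xi>" for n
    using h[of n] by (intro second_difference_mvt[of "h n" "\<lambda>t s. u s t" "\<lambda>t s. ut s t"] ut uts) auto
  then obtain \<xi>' \<eta>' where 2: "\<And>n. 0 < \<xi>' n \<and> \<xi>' n < h n \<and> 0 < \<eta>' n \<and> \<eta>' n < h n \<and>
      u (h n) (h n) - u 0 (h n) - u (h n) 0 + u 0 0 = h n * h n * uts (\<eta>' n) (\<xi>' n)"
    by metis
  have lim0: "f \<longlonglongrightarrow> 0" if "\<And>n. 0 < f n \<and> f n < h n" for f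
    using that by (intro tendsto_sandwich[OF _ _ tendsto_const h0] always_eventually allI)
      (auto simp: less_imp_le)
  have "(\<lambda>n. ust (\<xi> n) (\<eta> n)) \<longlonglongrightarrow> ust 0 0"
    using isCont_tendsto_compose[OF cont(1) tendsto_Pair[OF lim0[of \<xi>] lim0[of \<eta>]]] 1 by simp
  moreover have "(\<lambda>n. uts (\<eta>' n) (\<xi>' n)) \<longlonglongrightarrow> uts 0 0"
    using isCont_tendsto_compose[OF cont(2) tendsto_Pair[OF lim0[of \<eta>'] lim0[of \<xi>']]] 2 by simp
  moreover have "ust (\<xi> n) (\<eta> n) = uts (\<eta>' n) (\<xi>' n)" for n
  proof -
    have "h n * h n * ust (\<xi> n) (\<eta> n) = h n * h n * uts (\<eta>' n) (\<xi>' n)"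
      using 1[of n] 2[of n] by linarith
    then show ?thesis
      using h(1)[of n] by simp
  qed
  ultimately show ?thesis
    using LIMSEQ_unique by simp
qed

text \<open>Real increments make sense for complex coordinates too, and there the holomorphic
  derivative restricts to the real one. A translation moves the point of differentiation from
  increment 0 to the parameter \<open>s\<close>.\<close>

lemma has_partial_real_line:
  assumes "has_partial f c e (b + axis c (of_real s))"
  shows "((\<lambda>s. f (b + axis c (of_real s))) has_vector_derivative e) (at s)"
proof -
  have 1: "((\<lambda>s'. of_real (s' - s)) has_derivative (\<lambda>h. of_real h :: 'a)) (at s)"
    by (auto intro!: derivative_eq_intros)
  have "((\<lambda>t. f (b + axis c (of_real s) + axis c t)) has_derivative (\<lambda>t. to_complex t * e))
      (at ((\<lambda>s'. of_real (s' - s)) s))"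
    using assms by (simp add: has_partial_def)
  from has_derivative_compose[OF 1 this]
  have "((\<lambda>s'. f (b + (axis c (of_real s) + axis c (of_real (s' - s))))) has_derivative
      (\<lambda>h. of_real h * e)) (at s)"
    by (simp add: to_complex_of_real add.assoc)
  then show ?thesis
    unfolding axis_add[symmetric] has_vector_derivative_def
    by (simp add: scaleR_conv_of_real)
qed

text \<open>Restricted to the real plane through \<open>p\<close> in the directions \<open>c\<close>
  and \<open>d\<close> and composed with a bounded linear \<open>R\<close>, finally
  \<open>Re\<close> and \<open>Im\<close>, the function becomes a real function of two real
  variables.\<close>

lemma partial_commute:
  fixes f :: "'k::real_or_complex ^ coord \<Rightarrow> complex"
  assumes "open D" "smooth_fun_on D f" "p \<in> D"
  shows "partial c (partial d f) p = partial d (partial c f) p"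
proof -
  define \<gamma> where "\<gamma> s t = p + axis c (of_real s) + axis d (of_real t :: 'k)" for s t
  have \<gamma>0: "\<gamma> 0 0 = p"
    by (simp add: \<gamma>_def)
  have cont\<gamma>: "continuous_on UNIV (\<lambda>x. \<gamma> (fst x) (snd x))"
  proof -
    have if_cont: "continuous_on UNIV (\<lambda>x. if b then f x else 0)" if "continuous_on UNIV f"
      for b and f :: "real \<times> real \<Rightarrow> 'k"
      using that by (cases b) auto
    have "continuous_on UNIV (\<lambda>x. \<chi> i. p $ i + (if i = c then of_real (fst x) else 0)
        + (if i = d then of_real (snd x) else (0::'k)))"
      by (intro continuous_on_vec_lambda continuous_on_add continuous_on_const if_cont)
        (auto intro!: continuous_intros)
    then show ?thesis
      by (rule back_subst[of "continuous_on UNIV"])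
        (simp add: \<gamma>_def axis_def vec_eq_iff fun_eq_iff)
  qed
  have "open {x. \<gamma> (fst x) (snd x) \<in> D}"
    using cont\<gamma> assms(1) by (simp add: continuous_on_open_vimage vimage_def)
  \<comment> \<open>An open set of the plane contains a box around the origin, so all sufficiently
    small parameters stay in \<open>D\<close>.\<close>
  then obtain A B where AB: "open A" "open B" "0 \<in> A" "0 \<in> B" "A \<times> B \<subseteq> {x. \<gamma> (fst x) (snd x) \<in> D}"
    using assms(3) \<gamma>0 by (elim open_prod_elim[of _ "(0, 0)"]) auto
  obtain r1 where r1: "r1 > 0" "ball 0 r1 \<subseteq> A"
    using AB open_contains_ball by metis
  obtain r2 where r2: "r2 > 0" "ball 0 r2 \<subseteq> B"
    using AB open_contains_ball by metis
  define r where "r = min r1 r2"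
  have r: "\<gamma> s t \<in> D" if "\<bar>s\<bar> < r" "\<bar>t\<bar> < r" for s t
    using that AB(5) r1(2) r2(2) by (force simp: r_def)
  have smooth: "smooth_fun_on D (partial e f)" for e
    using assms(2) by (rule smooth_fun_on_partial)
  have isCont: "isCont (\<lambda>x. R (partial e (partial e' f) (\<gamma> (fst x) (snd x)))) (0, 0)"
    if "bounded_linear R" for R :: "complex \<Rightarrow> real" and e e'
  proof -
    have "continuous_on D (partial e (partial e' f))"
      using smooth_fun_on_partial[OF smooth, of e e'] by (auto simp: smooth_fun_on_def Ck_on_continuous)
    then have "isCont (partial e (partial e' f)) (\<gamma> (fst (0, 0)) (snd (0, 0)))"
      using assms(1,3) \<gamma>0 by (simp add: continuous_on_eq_continuous_at)
    moreover have "isCont (\<lambda>x. \<gamma> (fst x) (snd x)) (0, 0)"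
      using cont\<gamma> by (simp add: continuous_on_eq_continuous_at)
    ultimately have "isCont (\<lambda>x. partial e (partial e' f) (\<gamma> (fst x) (snd x))) (0, 0)"
      by (rule isCont_o2[rotated])
    then show ?thesis
      by (rule bounded_linear.isCont[OF that])
  qed
  have dc: "((\<lambda>s. R (F (\<gamma> s t))) has_real_derivative R (partial c F (\<gamma> s t))) (at s)"
    and dd: "((\<lambda>t. R (F (\<gamma> s t))) has_real_derivative R (partial d F (\<gamma> s t))) (at t)"
    if "bounded_linear R" "smooth_fun_on D F" "\<bar>s\<bar> < r" "\<bar>t\<bar> < r"
    for R :: "complex \<Rightarrow> real" and F s t
  proof -
    have "has_partial F c (partial c F (\<gamma> s t)) ((p + axis d (of_real t)) + axis c (of_real s))"
      using smooth_fun_on_has_partial[OF that(2) r[OF that(3,4)]] by (simp add: \<gamma>_def add_ac)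
    from bounded_linear.has_vector_derivative[OF that(1) has_partial_real_line[OF this]]
    show "((\<lambda>s. R (F (\<gamma> s t))) has_real_derivative R (partial c F (\<gamma> s t))) (at s)"
      by (simp add: has_real_derivative_iff_has_vector_derivative \<gamma>_def add_ac)
    have "has_partial F d (partial d F (\<gamma> s t)) ((p + axis c (of_real s)) + axis d (of_real t))"
      using smooth_fun_on_has_partial[OF that(2) r[OF that(3,4)]] by (simp add: \<gamma>_def)
    from bounded_linear.has_vector_derivative[OF that(1) has_partial_real_line[OF this]]
    show "((\<lambda>t. R (F (\<gamma> s t))) has_real_derivative R (partial d F (\<gamma> s t))) (at t)"
      by (simp add: has_real_derivative_iff_has_vector_derivative \<gamma>_def)
  qed
  have "R (partial d (partial c f) p) = R (partial c (partial d f) p)" if "bounded_linear R"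
    for R :: "complex \<Rightarrow> real"
    using clairaut_real[of r "\<lambda>s t. R (f (\<gamma> s t))" "\<lambda>s t. R (partial c f (\<gamma> s t))"
        "\<lambda>s t. R (partial d f (\<gamma> s t))" "\<lambda>s t. R (partial d (partial c f) (\<gamma> s t))"
        "\<lambda>s t. R (partial c (partial d f) (\<gamma> s t))"]
      dc[OF that] dd[OF that] assms(2) smooth isCont[OF that] r1(1) r2(1)
    by (simp add: \<gamma>0 r_def)
  then show ?thesis
    using bounded_linear_Re bounded_linear_Im by (metis complex_eqI)
qed

subsection \<open>Smooth matrix functions\<close>

text \<open>By Cramer's rule each component of the solution is a quotient of determinants, which are
  polynomials in smooth entries. Nothing is presupposed about the regularity of
  \<open>x\<close>.\<close>

lemma smooth_fun_on_solve:
  fixes A :: "'k::real_or_complex ^ coord \<Rightarrow> complex ^ 'n ^ 'n"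
  assumes "open D" "\<And>i j. smooth_fun_on D (\<lambda>q. A q $ i $ j)" "\<And>i. smooth_fun_on D (\<lambda>q. b q $ i)"
    "\<And>q. q \<in> D \<Longrightarrow> invertible (A q)" "\<And>q. q \<in> D \<Longrightarrow> A q *v x q = b q"
  shows "smooth_fun_on D (\<lambda>q. x q $ k)"
proof (rule smooth_fun_on_cong[OF assms(1)])
  show "smooth_fun_on D (\<lambda>q. det (\<chi> i j. if j = k then b q $ i else A q $ i $ j) / det (A q))"
  proof (intro smooth_fun_on_divide smooth_fun_on_det assms(1,2))
    show "smooth_fun_on D (\<lambda>q. (\<chi> i j. if j = k then b q $ i else A q $ i $ j) $ i $ j)" for i j
      using assms(2,3) by (cases "j = k") simp_all
  qed (use assms(4) in \<open>simp add: invertible_det_nz\<close>)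
next
  fix q assume "q \<in> D"
  then have "det (A q) \<noteq> 0" "A q *v x q = b q"
    using assms(4,5) by (simp_all add: invertible_det_nz[symmetric])
  then show "det (\<chi> i j. if j = k then b q $ i else A q $ i $ j) / det (A q) = x q $ k"
    by (simp add: cramer)
qed

lemma smooth_mat_on_subset: "smooth_mat_on D F \<Longrightarrow> E \<subseteq> D \<Longrightarrow> smooth_mat_on E F"
  by (auto simp: smooth_mat_on_def intro: smooth_fun_on_subset)

lemma smooth_mat_on_cong:
  assumes "open D" "\<And>q. q \<in> D \<Longrightarrow> F q = G q" "smooth_mat_on D F"
  shows "smooth_mat_on D G"
  unfolding smooth_mat_on_def
proof (intro allI)
  show "smooth_fun_on D (\<lambda>q. G q $ i $ j)" for i j
    by (rule smooth_fun_on_cong[OF assms(1), of "\<lambda>q. F q $ i $ j"])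
      (use assms(2,3) in \<open>auto simp: smooth_mat_on_def\<close>)
qed

lemma smooth_mat_on_const: "open D \<Longrightarrow> smooth_mat_on D (\<lambda>q. A)"
  by (simp add: smooth_mat_on_def smooth_fun_on_const)

lemma smooth_mat_on_add:
  "open D \<Longrightarrow> smooth_mat_on D F \<Longrightarrow> smooth_mat_on D G \<Longrightarrow> smooth_mat_on D (\<lambda>q. F q + G q)"
  by (simp add: smooth_mat_on_def smooth_fun_on_add)

lemma smooth_mat_on_minus: "open D \<Longrightarrow> smooth_mat_on D F \<Longrightarrow> smooth_mat_on D (\<lambda>q. - F q)"
  by (simp add: smooth_mat_on_def smooth_fun_on_minus)

lemma smooth_mat_on_mult:
  "open D \<Longrightarrow> smooth_mat_on D F \<Longrightarrow> smooth_mat_on D G \<Longrightarrow> smooth_mat_on D (\<lambda>q. F q ** G q)"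
  by (simp add: smooth_mat_on_def matrix_matrix_mult_def smooth_fun_on_sum smooth_fun_on_mult)

text \<open>Column \<open>j\<close> of the inverse solves the linear system whose right-hand side is
  the unit vector \<open>axis j 1\<close>.\<close>

lemma smooth_mat_on_inverse:
  fixes F :: "'k::real_or_complex ^ coord \<Rightarrow> complex ^ 'n ^ 'n"
  assumes "open D" "smooth_mat_on D F" "\<And>q. q \<in> D \<Longrightarrow> invertible (F q)"
  shows "smooth_mat_on D (\<lambda>q. matrix_inv (F q))"
  unfolding smooth_mat_on_def
proof (intro allI)
  fix i j
  have "smooth_fun_on D (\<lambda>q. (matrix_inv (F q) *v axis j 1) $ i)"
  proof (rule smooth_fun_on_solve[of D F "\<lambda>q. axis j 1"])
    show "F q *v (matrix_inv (F q) *v axis j 1) = axis j 1" if "q \<in> D" for q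
      using assms(3)[OF that] by (simp add: matrix_vector_mul_assoc matrix_inv_right)
  qed (use assms in \<open>simp_all add: smooth_mat_on_def smooth_fun_on_const\<close>)
  then show "smooth_fun_on D (\<lambda>q. matrix_inv (F q) $ i $ j)"
    by (simp add: matrix_vector_mult_def axis_def if_distrib[of "\<lambda>x. _ * x"] cong: if_cong)
qed

lemma smooth_mat_on_mat_partial: "smooth_mat_on D F \<Longrightarrow> smooth_mat_on D (mat_partial c F)"
  by (simp add: smooth_mat_on_def mat_partial_def smooth_fun_on_partial)

lemma open_invertible:
  fixes F :: "'k::real_or_complex ^ coord \<Rightarrow> complex ^ 'n ^ 'n"
  assumes "open D" "smooth_mat_on D F"
  shows "open {p \<in> D. invertible (F p)}"
proof -
  have "smooth_fun_on D (\<lambda>q. det (F q))"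
    using assms by (simp add: smooth_fun_on_det smooth_mat_on_def)
  then have "continuous_on D (\<lambda>q. det (F q))"
    by (auto simp: smooth_fun_on_def Ck_on_continuous)
  then have "open (D \<inter> (\<lambda>q. det (F q)) -` (- {0}))"
    using assms(1) by (intro continuous_open_preimage) auto
  moreover have "D \<inter> (\<lambda>q. det (F q)) -` (- {0}) = {p \<in> D. invertible (F p)}"
    by (auto simp: invertible_det_nz)
  ultimately show ?thesis
    by simp
qed

section \<open>Differentiation rules for matrix functions\<close>

lemma mat_partial_cong:
  assumes "open D" "p \<in> D" "\<And>q. q \<in> D \<Longrightarrow> F q = G q"
  shows "mat_partial c F p = mat_partial c G p"
proof -
  have "partial c (\<lambda>q. F q $ i $ j) p = partial c (\<lambda>q. G q $ i $ j) p" for i j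
    by (rule partial_cong[OF assms(1,2)]) (simp add: assms(3))
  then show ?thesis
    by (simp add: mat_partial_def)
qed

lemma mat_partial_const: "mat_partial c (\<lambda>q. A) p = 0"
  by (simp add: mat_partial_def vec_eq_iff partial_eqI[OF has_partial_const])

lemma has_partial_mat:
  "smooth_mat_on D F \<Longrightarrow> p \<in> D \<Longrightarrow> has_partial (\<lambda>q. F q $ i $ j) c (mat_partial c F p $ i $ j) p"
  using smooth_fun_on_has_partial[of D "\<lambda>q. F q $ i $ j"] by (simp add: smooth_mat_on_def mat_partial_def)

lemma has_partial_sum:
  "(\<And>i. i \<in> I \<Longrightarrow> has_partial (f i) c (d i) p) \<Longrightarrow>
    has_partial (\<lambda>q. \<Sum>i\<in>I. f i q) c (\<Sum>i\<in>I. d i) p"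
  by (induction I rule: infinite_finite_induct) (simp_all add: has_partial_const has_partial_add)

lemma mat_partialI:
  "(\<And>i j. has_partial (\<lambda>q. F q $ i $ j) c (A $ i $ j) p) \<Longrightarrow> mat_partial c F p = A"
  by (simp add: mat_partial_def vec_eq_iff partial_eqI)

lemma mat_partial_add:
  assumes "smooth_mat_on D F" "smooth_mat_on D G" "p \<in> D"
  shows "mat_partial c (\<lambda>q. F q + G q) p = mat_partial c F p + mat_partial c G p"
  using assms by (intro mat_partialI) (simp add: has_partial_add has_partial_mat)

lemma mat_partial_mult:
  assumes "smooth_mat_on D F" "smooth_mat_on D G" "p \<in> D"
  shows "mat_partial c (\<lambda>q. F q ** G q) p = mat_partial c F p ** G p + F p ** mat_partial c G p"
proof (rule mat_partialI)
  fix i j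
  show "has_partial (\<lambda>q. (F q ** G q) $ i $ j) c
      ((mat_partial c F p ** G p + F p ** mat_partial c G p) $ i $ j) p"
    unfolding matrix_matrix_mult_def vector_add_component vec_lambda_beta sum.distrib[symmetric]
    by (intro has_partial_sum has_partial_mult has_partial_mat[OF assms(1,3)]
        has_partial_mat[OF assms(2,3)])
qed

lemma mat_partial_minus:
  assumes "smooth_mat_on D F" "p \<in> D"
  shows "mat_partial c (\<lambda>q. - F q) p = - mat_partial c F p"
proof (rule mat_partialI)
  show "has_partial (\<lambda>q. (- F q) $ i $ j) c ((- mat_partial c F p) $ i $ j) p" for i j
    using has_partial_mult[OF has_partial_const[of "-1"] has_partial_mat[OF assms]] by simp
qed

lemma mat_partial_diff:
  assumes "open D" "smooth_mat_on D F" "smooth_mat_on D G" "p \<in> D"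
  shows "mat_partial c (\<lambda>q. F q - G q) p = mat_partial c F p - mat_partial c G p"
  using mat_partial_add[OF assms(2) smooth_mat_on_minus[OF assms(1,3)] assms(4)]
    mat_partial_minus[OF assms(3,4)] by simp

text \<open>The product of \<open>F\<close> and its inverse is constant on the open set
  \<open>D\<close>; its derivative vanishes, and \<open>F\<close> is cancelled on the left.\<close>

lemma mat_partial_inverse:
  fixes F :: "'k::real_or_complex ^ coord \<Rightarrow> complex ^ 'n ^ 'n"
  assumes "open D" "smooth_mat_on D F" "\<And>q. q \<in> D \<Longrightarrow> invertible (F q)" "p \<in> D"
  shows "mat_partial c (\<lambda>q. matrix_inv (F q)) p =
    - (matrix_inv (F p) ** mat_partial c F p ** matrix_inv (F p))"
proof -
  let ?G = "\<lambda>q. matrix_inv (F q)"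
  have "mat_partial c F p ** ?G p + F p ** mat_partial c ?G p = mat_partial c (\<lambda>q. F q ** ?G q) p"
    by (rule mat_partial_mult[OF assms(2) smooth_mat_on_inverse[OF assms(1-3)] assms(4), symmetric])
  also have "\<dots> = mat_partial c (\<lambda>q. mat 1) p"
    by (rule mat_partial_cong[OF assms(1,4)]) (simp add: matrix_inv_right assms(3))
  finally have "F p ** mat_partial c ?G p = - (mat_partial c F p ** ?G p)"
    by (simp add: mat_partial_const add_eq_0_iff)
  then have "?G p ** (F p ** mat_partial c ?G p) = ?G p ** - (mat_partial c F p ** ?G p)"
    by simp
  then show ?thesis
    using assms(3,4) by (simp add: matrix_mul_assoc matrix_inv_left matrix_minus_right)
qed

lemma mat_partial_commute:
  assumes "open D" "smooth_mat_on D F" "p \<in> D"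
  shows "mat_partial c (mat_partial d F) p = mat_partial d (mat_partial c F) p"
proof -
  have "(\<lambda>q. mat_partial e F q $ i $ j) = partial e (\<lambda>q. F q $ i $ j)" for e i j
    by (simp add: mat_partial_def fun_eq_iff)
  then show ?thesis
    using assms partial_commute[OF assms(1) _ assms(3)]
    by (simp add: mat_partial_def[of _ "mat_partial _ _"] smooth_mat_on_def)
qed

text \<open>Read as a system for the n^2 entries of \<open>X\<close>, the Sylvester equation has
  smooth coefficients and a constant right-hand side. Its matrix is square, so the trivial kernel
  coming from the disjoint spectra makes it invertible.\<close>

lemma smooth_sylvester_solution:
  fixes P Q X :: "'k::real_or_complex ^ coord \<Rightarrow> complex ^ 'n ^ 'n"
  assumes "open D" "smooth_mat_on D P" "smooth_mat_on D Q"
    and disj: "\<And>p. p \<in> D \<Longrightarrow> mat_spectrum (P p) \<inter> mat_spectrum (Q p) = {}"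
    and syl: "\<And>p. p \<in> D \<Longrightarrow> X p ** P p - Q p ** X p = C"
  shows "smooth_mat_on D X"
proof -
  \<comment> \<open>For \<open>a = (i, j)\<close> and \<open>b = (k, l)\<close> this is the
    coefficient of \<open>S $ k $ l\<close> in entry (i, j) of \<open>S ** P q - Q q ** S\<close>,
    that is, the Kronecker expression I \<otimes> P^T - Q \<otimes> I.\<close>
  define M :: "'k ^ coord \<Rightarrow> complex ^ ('n \<times> 'n) ^ ('n \<times> 'n)"
    where "M q = (\<chi> a b. (if fst a = fst b then P q $ snd b $ snd a else 0)
      - (if snd b = snd a then Q q $ fst a $ fst b else 0))" for q
  define vec :: "complex ^ 'n ^ 'n \<Rightarrow> complex ^ ('n \<times> 'n)"
    where "vec S = (\<chi> a. S $ fst a $ snd a)" for S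
  have M: "M q *v vec S = vec (S ** P q - Q q ** S)" for q S
  proof -
    have "(M q *v vec S) $ (i, j) = (S ** P q - Q q ** S) $ i $ j" for i j
    proof -
      have "(M q *v vec S) $ (i, j) = (\<Sum>k\<in>UNIV. \<Sum>l\<in>UNIV.
          ((if i = k then P q $ l $ j else 0) - (if l = j then Q q $ i $ k else 0)) * S $ k $ l)"
        by (simp add: matrix_vector_mult_def M_def vec_def sum.cartesian_product
            UNIV_Times_UNIV[symmetric] case_prod_unfold
            del: UNIV_Times_UNIV cong: if_cong)
      also have "\<dots> = (\<Sum>k\<in>UNIV. (if i = k then \<Sum>l\<in>UNIV. P q $ l $ j * S $ k $ l else 0)
          - Q q $ i $ k * S $ k $ j)"
      proof (intro sum.cong refl)
        fix k
        have "(\<Sum>l\<in>UNIV. (if l = j then Q q $ i $ k else 0) * S $ k $ l) = Q q $ i $ k * S $ k $ j"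
          by (simp add: if_distrib[of "\<lambda>x. x * _"] cong: if_cong)
        then show "(\<Sum>l\<in>UNIV. ((if i = k then P q $ l $ j else 0) - (if l = j then Q q $ i $ k else 0))
            * S $ k $ l) = (if i = k then \<Sum>l\<in>UNIV. P q $ l $ j * S $ k $ l else 0)
            - Q q $ i $ k * S $ k $ j"
          by (simp add: left_diff_distrib sum_subtractf)
      qed
      also have "\<dots> = (S ** P q - Q q ** S) $ i $ j"
        by (simp add: matrix_matrix_mult_def sum_subtractf mult.commute)
      finally show ?thesis .
    qed
    then show ?thesis
      by (simp add: vec_eq_iff vec_def)
  qed
  have "smooth_fun_on D (\<lambda>q. vec (X q) $ a)" for a
  proof (rule smooth_fun_on_solve[OF assms(1)])
    show "smooth_fun_on D (\<lambda>q. M q $ a $ b)" for a b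
      unfolding M_def vec_lambda_beta using assms(1-3)
      by (intro smooth_fun_on_diff smooth_fun_on_if smooth_fun_on_const)
        (simp_all add: smooth_mat_on_def)
    show "smooth_fun_on D (\<lambda>q. vec C $ a)" for a
      by (rule smooth_fun_on_const[OF assms(1)])
    show "M q *v vec (X q) = vec C" if "q \<in> D" for q
      using M syl[OF that] by simp
    show "invertible (M q)" if "q \<in> D" for q
    proof -
      have "x = 0" if "M q *v x = 0" for x
      proof -
        define S :: "complex ^ 'n ^ 'n" where "S = (\<chi> i j. x $ (i, j))"
        have x: "x = vec S"
          by (simp add: vec_def S_def vec_eq_iff)
        then have "vec (S ** P q - Q q ** S) = 0"
          using that M by simp
        then have "S ** P q - Q q ** S = 0"
          by (simp add: vec_def vec_eq_iff split_paired_all)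
        then have "S = 0"
          using intertwiner_eq_0[OF disj[OF \<open>q \<in> D\<close>]] by simp
        then show "x = 0"
          by (simp add: x vec_def vec_eq_iff)
      qed
      then show ?thesis
        by (metis invertible_left_inverse matrix_left_invertible_ker)
    qed
  qed
  then have "smooth_fun_on D (\<lambda>q. vec (X q) $ (i, j))" for i j
    by blast
  then show ?thesis
    by (simp add: smooth_mat_on_def vec_def)
qed

subsection \<open>The dressing construction\<close>

lemma sylvester_partial:
  fixes P Q X :: "'k::real_or_complex ^ coord \<Rightarrow> complex ^ 'n ^ 'n"
  assumes "open D" "smooth_mat_on D P" "smooth_mat_on D Q" "smooth_mat_on D X"
    and syl: "\<And>q. q \<in> D \<Longrightarrow> X q ** P q - Q q ** X q = C"
    and "p \<in> D"
  shows "mat_partial c X p ** P p + X p ** mat_partial c P p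
    = mat_partial c Q p ** X p + Q p ** mat_partial c X p"
proof -
  have "mat_partial c (\<lambda>q. X q ** P q - Q q ** X q) p = mat_partial c (\<lambda>q. C) p"
    by (rule mat_partial_cong[OF assms(1,6) syl])
  then show ?thesis
    using assms by (simp add: mat_partial_diff[of D] mat_partial_mult[of D] smooth_mat_on_mult
        mat_partial_const)
qed

text \<open>
  Both sides solve the same Sylvester equation. The index \<open>a\<close> stands for the derivative in \<open>Zbar\<close>
  or \<open>Y\<close>, and \<open>b\<close> for the derivative in \<open>Ybar\<close> or the negated derivative in \<open>Z\<close>, respectively.
\<close>

lemma sylvester_derivative_relation:
  fixes P Q X Xa Xb Pa Pb Qa Qb :: "complex ^ 'n ^ 'n"
  assumes "mat_spectrum P \<inter> mat_spectrum Q = {}"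
    and a: "Xa ** P + X ** Pa = Qa ** X + Q ** Xa"
    and b: "Xb ** P + X ** Pb = Qb ** X + Q ** Xb"
    and P: "Pa = Pb ** P" and Q: "Qa = Q ** Qb"
  shows "Xa = Xb ** P - Qb ** X"
proof (rule sylvester_unique[OF assms(1)])
  \<comment> \<open>Both sides come down to this expression: one through \<open>a\<close>, the other
    through \<open>b\<close> multiplied by \<open>P\<close> from the right.\<close>
  have "Xa ** P - Q ** Xa = Q ** Qb ** X - X ** Pb ** P"
    using a unfolding P Q by (simp add: matrix_mul_assoc algebra_simps)
  moreover have "Xb ** P ** P = Qb ** X ** P + Q ** Xb ** P - X ** Pb ** P"
    using arg_cong[OF b, of "\<lambda>M. M ** P"] by (simp add: matrix_add_rdistrib algebra_simps)
  ultimately show "Xa ** P - Q ** Xa = (Xb ** P - Qb ** X) ** P - Q ** (Xb ** P - Qb ** X)"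
    by (simp add: matrix_diff_ldistrib matrix_diff_rdistrib matrix_mul_assoc)
qed

text \<open>The left-hand side is the equation for \<phi> stripped of the outer factors
  \<open>U0 ** Xi\<close> and \<open>Xi ** V0\<close>; \<open>M\<close> stands for the mixed second
  derivatives of \<open>X\<close>, and the terms with \<open>C\<close> form the commutator. Each of
  \<open>Xzb\<close> and \<open>Xy\<close> has two expressions, and in every product the one is
  chosen that lets the adjacent \<open>Xi\<close> cancel an \<open>X\<close>. What survives cancels
  against the commutator, since \<open>Xi ** C ** Xi = P ** Xi - Xi ** Q\<close>, and against
  \<open>M\<close>.\<close>

lemma phi_bracket_eq_0:
  fixes P Q X Xi C :: "complex ^ 'n ^ 'n"
  assumes inv: "X ** Xi = mat 1" "Xi ** X = mat 1"
    and syl: "X ** P - Q ** X = C"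
    and Xzb: "Xzb = Xyb ** P - Qyb ** X" and Xy: "Xy = Qz ** X - Xz ** P"
    and yb: "Xyb ** P + X ** Pyb = Qyb ** X + Q ** Xyb"
    and z: "Xz ** P + X ** Pz = Qz ** X + Q ** Xz"
    and mixed: "M = Xyb ** Pz - Qyb ** Xz - Xz ** Pyb + Qz ** Xyb"
  shows "Xzb ** Xi ** Xz + Xz ** Xi ** Xzb + Xyb ** Xi ** Xy + Xy ** Xi ** Xyb - M
    + Xz ** (Xi ** C ** Xi) ** Xyb - Xyb ** (Xi ** C ** Xi) ** Xz = 0"
proof -
  have inv': "A ** X ** Xi = A" "A ** Xi ** X = A" for A :: "complex ^ 'n ^ 'n"
    using inv by (simp_all add: matrix_mul_assoc[symmetric])
  have C: "Xi ** C ** Xi = P ** Xi - Xi ** Q"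
    by (simp add: syl[symmetric] matrix_diff_ldistrib matrix_diff_rdistrib matrix_mul_assoc inv inv')
  have 1: "Xzb ** Xi = Xyb ** P ** Xi - Qyb"
    by (simp add: Xzb matrix_diff_rdistrib inv')
  have 2: "Xy ** Xi = Qz - Xz ** P ** Xi"
    by (simp add: Xy matrix_diff_rdistrib inv')
  \<comment> \<open>The second expression, from the differentiated Sylvester equation, has
    \<open>X\<close> as a left factor and suits an \<open>Xi\<close> on its left.\<close>
  have "Xzb = Q ** Xyb - X ** Pyb"
    using yb unfolding Xzb by (simp add: algebra_simps)
  then have 3: "Xz ** Xi ** Xzb = Xz ** Xi ** Q ** Xyb - Xz ** Pyb"
    by (simp add: matrix_diff_ldistrib matrix_mul_assoc inv')
  have "Xy = X ** Pz - Q ** Xz"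
    using z unfolding Xy by (simp add: algebra_simps)
  then have 4: "Xyb ** Xi ** Xy = Xyb ** Pz - Xyb ** Xi ** Q ** Xz"
    by (simp add: matrix_diff_ldistrib matrix_mul_assoc inv')
  show ?thesis
    unfolding 1 2 3 4 C mixed
    by (simp add: matrix_diff_ldistrib matrix_diff_rdistrib matrix_mul_assoc)
qed

text \<open>Up to sign, the left-hand side is the a-derivative of the dressing factor of
  \<open>g\<close>, and the right-hand side is the b-derivative of \<phi> times that factor. The
  \<open>Qb\<close> part of \<open>Xa\<close> cancels the contribution of \<open>Qa\<close>, and
  \<open>P ** Xi = Xi ** Q + Xi ** V ** U ** Xi\<close> splits the rest into the two terms of the
  factor.\<close>

lemma dressing_factor_derivative:
  fixes P Q X Xi Qi Xa Xb Qa Qb :: "complex ^ 'n ^ 'n"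
    and U :: "complex ^ 'n ^ 'm" and V :: "complex ^ 'm ^ 'n"
  assumes inv: "X ** Xi = mat 1" "Xi ** X = mat 1" "Q ** Qi = mat 1" "Qi ** Q = mat 1"
    and syl: "X ** P - Q ** X = V ** U"
    and Xa: "Xa = Xb ** P - Qb ** X" and Qa: "Qa = Q ** Qb"
  shows "U ** (Xi ** Xa ** Xi ** Qi + Xi ** (Qi ** Qa ** Qi)) ** V
    = U ** (Xi ** Xb ** Xi) ** V ** (mat 1 + U ** (Xi ** Qi) ** V)"
proof -
  have inv': "A ** X ** Xi = A" "A ** Xi ** X = A" "A ** Q ** Qi = A" "A ** Qi ** Q = A"
    for A :: "complex ^ 'n ^ 'n"
    using inv by (simp_all add: matrix_mul_assoc[symmetric])
  have "P ** Xi = Xi ** Q + Xi ** V ** U ** Xi"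
  proof -
    have "Xi ** (X ** P - Q ** X) ** Xi = Xi ** (V ** U) ** Xi"
      by (simp add: syl)
    then show ?thesis
      by (simp add: matrix_diff_ldistrib matrix_diff_rdistrib matrix_mul_assoc inv inv' algebra_simps)
  qed
  then have "Xi ** Xb ** (P ** Xi) ** Qi = Xi ** Xb ** Xi + Xi ** Xb ** Xi ** V ** U ** Xi ** Qi"
    by (simp add: matrix_add_ldistrib matrix_add_rdistrib matrix_mul_assoc inv')
  moreover have "Xi ** Xa ** Xi ** Qi + Xi ** (Qi ** Qa ** Qi) = Xi ** Xb ** (P ** Xi) ** Qi"
    by (simp add: Xa Qa matrix_diff_ldistrib matrix_diff_rdistrib matrix_mul_assoc inv inv')
  ultimately show ?thesis
    by (simp add: matrix_add_ldistrib matrix_add_rdistrib matrix_mul_assoc)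
qed

theorem proposition5p2:
  fixes \<Omega> :: "('k::real_or_complex ^ coord) set"
    and P Q X :: "'k ^ coord \<Rightarrow> complex ^ 'n ^ 'n"
    and U0 :: "complex ^ 'n ^ 'm"
    and V0 :: "complex ^ 'm ^ 'n"
    and \<phi>0 g0 :: "complex ^ 'm ^ 'm"
    and \<phi> g :: "'k ^ coord \<Rightarrow> complex ^ 'm ^ 'm"
  assumes "open \<Omega>"
    and "invertible g0"
    and "smooth_mat_on \<Omega> P" and "smooth_mat_on \<Omega> Q"
    and "\<And>p. p \<in> \<Omega> \<Longrightarrow> mat_partial Y P p = - (mat_partial Z P p ** P p)"
    and "\<And>p. p \<in> \<Omega> \<Longrightarrow> mat_partial Zbar P p = mat_partial Ybar P p ** P p"
    and "\<And>p. p \<in> \<Omega> \<Longrightarrow> mat_partial Y Q p = - (Q p ** mat_partial Z Q p)"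
    and "\<And>p. p \<in> \<Omega> \<Longrightarrow> mat_partial Zbar Q p = Q p ** mat_partial Ybar Q p"
    and "\<And>p. p \<in> \<Omega> \<Longrightarrow> invertible (Q p)"
    and "\<And>p. p \<in> \<Omega> \<Longrightarrow> mat_spectrum (P p) \<inter> mat_spectrum (Q p) = {}"
    and "\<And>p. p \<in> \<Omega> \<Longrightarrow> X p ** P p - Q p ** X p = V0 ** U0"
    and "\<And>p. \<phi> p = \<phi>0 + U0 ** matrix_inv (X p) ** V0"
    and "\<And>p. g p = (mat 1 + U0 ** matrix_inv (Q p ** X p) ** V0) ** g0"
  shows "(\<forall>p\<in>\<Omega>. \<exists>!S. S ** P p - Q p ** S = V0 ** U0)
    \<and> solves_phi_eq_on {p \<in> \<Omega>. invertible (X p)} \<phi>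
    \<and> solves_g_eq_on {p \<in> \<Omega>. invertible (X p) \<and> invertible (g p)} g"
proof (intro conjI)
  note Q_inv = assms(9) and disj = assms(10) and syl = assms(11)
  \<comment> \<open>\<open>X p\<close> is the witness; the spectral condition gives
    uniqueness.\<close>
  show "\<forall>p\<in>\<Omega>. \<exists>!S. S ** P p - Q p ** S = V0 ** U0"
    using syl sylvester_unique[OF disj] by metis
  define D where "D = {p \<in> \<Omega>. invertible (X p)}"
  have "smooth_mat_on \<Omega> X"
    by (rule smooth_sylvester_solution[OF assms(1,3,4) disj syl])
  then have "open D"
    unfolding D_def by (rule open_invertible[OF assms(1)])
  have D: "p \<in> \<Omega>" "invertible (X p)" if "p \<in> D" for p
    using that by (auto simp: D_def)
  have smooth: "smooth_mat_on D P" "smooth_mat_on D Q" "smooth_mat_on D X"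
    using assms(3,4) \<open>smooth_mat_on \<Omega> X\<close> smooth_mat_on_subset[of \<Omega> _ D] D(1) by blast+
  define Xi where "Xi p = matrix_inv (X p)" for p
  define Qi where "Qi p = matrix_inv (Q p)" for p
  have inv: "X p ** Xi p = mat 1" "Xi p ** X p = mat 1" "Q p ** Qi p = mat 1" "Qi p ** Q p = mat 1"
    if "p \<in> D" for p
    using D[OF that] Q_inv by (simp_all add: Xi_def Qi_def matrix_inv_left matrix_inv_right)
  have smooth_inv: "smooth_mat_on D Xi" "smooth_mat_on D Qi"
    unfolding Xi_def Qi_def using D Q_inv
    by (auto intro!: smooth_mat_on_inverse \<open>open D\<close> smooth)
  note smooth_intros = \<open>open D\<close> smooth smooth_inv smooth_mat_on_mat_partial smooth_mat_on_const
    smooth_mat_on_add smooth_mat_on_minus smooth_mat_on_mult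
  have Xi_c: "mat_partial c Xi p = - (Xi p ** mat_partial c X p ** Xi p)" if "p \<in> D" for c p
    unfolding Xi_def by (rule mat_partial_inverse[OF \<open>open D\<close> smooth(3) D(2) that])
  have Qi_c: "mat_partial c Qi p = - (Qi p ** mat_partial c Q p ** Qi p)" if "p \<in> D" for c p
    unfolding Qi_def by (rule mat_partial_inverse[OF \<open>open D\<close> smooth(2) Q_inv[OF D(1)] that])
  have syl_c: "mat_partial c X p ** P p + X p ** mat_partial c P p
      = mat_partial c Q p ** X p + Q p ** mat_partial c X p" if "p \<in> D" for c p
    by (rule sylvester_partial[OF \<open>open D\<close> smooth syl[OF D(1)] that])
  have X_Zbar: "mat_partial Zbar X p = mat_partial Ybar X p ** P p - mat_partial Ybar Q p ** X p"
    if "p \<in> D" for p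
    by (rule sylvester_derivative_relation[OF disj[OF D(1)[OF that]] syl_c[OF that] syl_c[OF that]])
      (rule assms(6,8)[OF D(1)[OF that]])+
  have X_Y: "mat_partial Y X p = (- mat_partial Z X p) ** P p - (- mat_partial Z Q p) ** X p"
    if "p \<in> D" for p
  proof (rule sylvester_derivative_relation[OF disj[OF D(1)[OF that]] syl_c[OF that]])
    show "(- mat_partial Z X p) ** P p + X p ** (- mat_partial Z P p)
        = (- mat_partial Z Q p) ** X p + Q p ** (- mat_partial Z X p)"
      using arg_cong[OF syl_c[OF that, of Z], of uminus]
      by (simp add: matrix_minus_left matrix_minus_right algebra_simps)
  qed (simp_all add: assms(5,7) D(1)[OF that] matrix_minus_left matrix_minus_right)
  have \<phi>_c: "mat_partial c \<phi> p = - (U0 ** (Xi p ** mat_partial c X p ** Xi p) ** V0)"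
    if "p \<in> D" for c p
  proof -
    have "\<phi> = (\<lambda>q. \<phi>0 + U0 ** Xi q ** V0)"
      using assms(12) by (simp add: Xi_def fun_eq_iff)
    then show ?thesis
      using that
      by (simp add: mat_partial_add[of D] mat_partial_mult[of D] smooth_intros mat_partial_const Xi_c
          matrix_minus_left matrix_minus_right)
  qed
  have smooth_\<phi>: "smooth_mat_on D \<phi>"
  proof -
    have "\<phi> = (\<lambda>q. \<phi>0 + U0 ** Xi q ** V0)"
      using assms(12) by (simp add: Xi_def fun_eq_iff)
    then show ?thesis
      by (simp add: smooth_intros)
  qed
  have \<phi>_cd: "mat_partial d (mat_partial c \<phi>) p = U0 ** Xi p **
      (mat_partial d X p ** Xi p ** mat_partial c X p - mat_partial d (mat_partial c X) p
        + mat_partial c X p ** Xi p ** mat_partial d X p) ** Xi p ** V0"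
    if "p \<in> D" for c d p
  proof -
    have "mat_partial d (mat_partial c \<phi>) p
        = mat_partial d (\<lambda>q. - (U0 ** (Xi q ** mat_partial c X q ** Xi q) ** V0)) p"
      by (rule mat_partial_cong[OF \<open>open D\<close> that \<phi>_c])
    also have "\<dots> = - (U0 ** (- (Xi p ** mat_partial d X p ** Xi p) ** mat_partial c X p ** Xi p
        + Xi p ** mat_partial d (mat_partial c X) p ** Xi p
        + Xi p ** mat_partial c X p ** - (Xi p ** mat_partial d X p ** Xi p)) ** V0)"
      using that
      by (simp add: mat_partial_minus[of D] mat_partial_mult[of D] smooth_intros mat_partial_const
          Xi_c matrix_add_rdistrib)
    finally show ?thesis
      by (simp add: matrix_ring matrix_mul_assoc algebra_simps)
  qed
  \<comment> \<open>For matrices of any shape: it is applied to the n x n matrices \<open>X\<close>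
    and \<open>Q\<close> and to the m x m matrix \<phi>.\<close>
  have commute: "mat_partial c (mat_partial d F) p = mat_partial d (mat_partial c F) p"
    if "smooth_mat_on D F" "p \<in> D" for c d p and F :: "'k ^ coord \<Rightarrow> complex ^ 'a ^ 'b"
    by (rule mat_partial_commute[OF \<open>open D\<close> that])
  \<comment> \<open>After exchanging derivatives, the two relations for \<open>X\<close> can be
    differentiated in \<open>Z\<close> and \<open>Ybar\<close>. The second derivatives of
    \<open>X\<close> and \<open>Q\<close> then occur with opposite signs, and only first derivatives
    remain.\<close>
  have X_mixed: "mat_partial Zbar (mat_partial Z X) p + mat_partial Ybar (mat_partial Y X) p
      = mat_partial Ybar X p ** mat_partial Z P p - mat_partial Ybar Q p ** mat_partial Z X p
        - mat_partial Z X p ** mat_partial Ybar P p + mat_partial Z Q p ** mat_partial Ybar X p"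
    if "p \<in> D" for p
  proof -
    have "mat_partial Z (mat_partial Zbar X) p
        = mat_partial Z (\<lambda>q. mat_partial Ybar X q ** P q - mat_partial Ybar Q q ** X q) p"
      by (rule mat_partial_cong[OF \<open>open D\<close> that X_Zbar])
    moreover have "mat_partial Ybar (mat_partial Y X) p
        = mat_partial Ybar (\<lambda>q. (- mat_partial Z X q) ** P q - (- mat_partial Z Q q) ** X q) p"
      by (rule mat_partial_cong[OF \<open>open D\<close> that X_Y])
    ultimately show ?thesis
      using that
      by (simp add: mat_partial_diff[of D] mat_partial_mult[of D] mat_partial_minus[of D]
          smooth_intros commute[OF smooth(3), of _ Zbar Z] commute[OF smooth(3), of _ Ybar Z]
          commute[OF smooth(2), of _ Ybar Z] matrix_minus_left)
  qed
  have "solves_phi_eq_on D \<phi>"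
    unfolding solves_phi_eq_on_def
  proof (intro conjI ballI)
    fix p assume p: "p \<in> D"
    define M where "M = mat_partial Zbar (mat_partial Z X) p + mat_partial Ybar (mat_partial Y X) p"
    let ?x = "\<lambda>c. mat_partial c X p"
    let ?B = "?x Zbar ** Xi p ** ?x Z + ?x Z ** Xi p ** ?x Zbar + ?x Ybar ** Xi p ** ?x Y
      + ?x Y ** Xi p ** ?x Ybar - M + ?x Z ** (Xi p ** (V0 ** U0) ** Xi p) ** ?x Ybar
      - ?x Ybar ** (Xi p ** (V0 ** U0) ** Xi p) ** ?x Z"
    have "?B = 0"
    proof (rule phi_bracket_eq_0[OF inv(1,2)[OF p] syl[OF D(1)[OF p]] X_Zbar[OF p] _
          syl_c[OF p] syl_c[OF p]])
      show "?x Y = mat_partial Z Q p ** X p - ?x Z ** P p"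
        using X_Y[OF p] by (simp add: matrix_minus_left)
    qed (simp add: M_def X_mixed[OF p])
    \<comment> \<open>By the formulas for the derivatives of \<phi> this product is the left-hand
      side of the equation; in the commutator \<open>V0\<close> meets \<open>U0\<close> between two
      inverses of \<open>X\<close>.\<close>
    then have "U0 ** Xi p ** ?B ** Xi p ** V0 = 0"
      by simp
    then show "mat_partial Zbar (mat_partial Z \<phi>) p + mat_partial Ybar (mat_partial Y \<phi>) p
        + commutator (mat_partial Z \<phi> p) (mat_partial Ybar \<phi> p) = 0"
      unfolding M_def \<phi>_cd[OF p] \<phi>_c[OF p] commutator_def
      by (simp add: matrix_ring matrix_mul_assoc algebra_simps)
  qed (use \<open>open D\<close> smooth_\<phi> in auto)
  then show "solves_phi_eq_on {p \<in> \<Omega>. invertible (X p)} \<phi>"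
    by (simp add: D_def)
  \<comment> \<open>On \<open>D\<close> both \<open>Q\<close> and \<open>X\<close> are invertible,
    so the inverse of their product factors and \<open>g\<close> may be differentiated through
    \<open>h\<close>.\<close>
  define h where "h q = (mat 1 + U0 ** (Xi q ** Qi q) ** V0) ** g0" for q
  have g: "g q = h q" if "q \<in> D" for q
    using D[OF that] Q_inv by (simp add: assms(13) h_def Xi_def Qi_def matrix_inv_mult)
  have smooth_g: "smooth_mat_on D g"
    by (rule smooth_mat_on_cong[OF \<open>open D\<close> g[symmetric]]) (simp_all add: h_def smooth_intros)
  have g_c: "mat_partial c g p = - (U0 ** (Xi p ** mat_partial c X p ** Xi p ** Qi p
      + Xi p ** (Qi p ** mat_partial c Q p ** Qi p)) ** V0 ** g0)" if "p \<in> D" for c p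
  proof -
    have "mat_partial c g p = mat_partial c h p"
      by (rule mat_partial_cong[OF \<open>open D\<close> that g])
    then show ?thesis
      using that unfolding h_def
      by (simp add: mat_partial_add[of D] mat_partial_mult[of D] smooth_intros mat_partial_const
          Xi_c Qi_c matrix_ring)
  qed
  \<comment> \<open>The relation for the dressing factor is multiplied by the constant
    \<open>g0\<close> from the right; differentiating an inverse puts a minus sign on both
    sides.\<close>
  have g_Zbar: "mat_partial Zbar g p = mat_partial Ybar \<phi> p ** g p" if "p \<in> D" for p
    unfolding g_c[OF that] \<phi>_c[OF that] g[OF that] h_def
    using dressing_factor_derivative[OF inv[OF that] syl[OF D(1)[OF that]] X_Zbar[OF that]
        assms(8)[OF D(1)[OF that]]]
    by (simp add: matrix_mul_assoc matrix_minus_left)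
  have g_Y: "mat_partial Y g p = - (mat_partial Z \<phi> p ** g p)" if "p \<in> D" for p
  proof -
    have "mat_partial Y Q p = Q p ** (- mat_partial Z Q p)"
      using assms(7)[OF D(1)[OF that]] by (simp add: matrix_minus_right)
    from dressing_factor_derivative[OF inv[OF that] syl[OF D(1)[OF that]] X_Y[OF that] this]
    show ?thesis
      unfolding g_c[OF that] \<phi>_c[OF that] g[OF that] h_def
      by (simp add: matrix_mul_assoc matrix_minus_left matrix_minus_right)
  qed
  define E where "E = {p \<in> D. invertible (g p)}"
  have "open E"
    unfolding E_def by (rule open_invertible[OF \<open>open D\<close> smooth_g])
  have E: "p \<in> D" "invertible (g p)" if "p \<in> E" for p
    using that by (auto simp: E_def)
  have "solves_g_eq_on E g"
    unfolding solves_g_eq_on_def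
  proof (intro conjI ballI)
    show "smooth_mat_on E g"
      using smooth_g smooth_mat_on_subset E(1) by blast
    fix p assume p: "p \<in> E"
    \<comment> \<open>Since \<open>E\<close> is open, cancelling \<open>g\<close> against its
      inverse is valid near \<open>p\<close>, so the resulting identity may be
      differentiated.\<close>
    have "mat_partial Z (\<lambda>q. mat_partial Zbar g q ** matrix_inv (g q)) p
        = mat_partial Z (mat_partial Ybar \<phi>) p"
      by (rule mat_partial_cong[OF \<open>open E\<close> p])
        (simp add: g_Zbar E matrix_mul_assoc[symmetric] matrix_inv_right)
    moreover have "mat_partial Ybar (\<lambda>q. mat_partial Y g q ** matrix_inv (g q)) p
        = mat_partial Ybar (\<lambda>q. - mat_partial Z \<phi> q) p"
      by (rule mat_partial_cong[OF \<open>open E\<close> p])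
        (simp add: g_Y E matrix_mul_assoc[symmetric] matrix_inv_right matrix_minus_left)
    moreover have "\<dots> = - mat_partial Ybar (mat_partial Z \<phi>) p"
      by (rule mat_partial_minus[OF smooth_mat_on_mat_partial[OF smooth_\<phi>] E(1)[OF p]])
    ultimately show "mat_partial Z (\<lambda>q. mat_partial Zbar g q ** matrix_inv (g q)) p
        + mat_partial Ybar (\<lambda>q. mat_partial Y g q ** matrix_inv (g q)) p = 0"
      using commute[OF smooth_\<phi> E(1)[OF p], of Z Ybar] by simp
  qed (use \<open>open E\<close> E in auto)
  then show "solves_g_eq_on {p \<in> \<Omega>. invertible (X p) \<and> invertible (g p)} g"
    by (simp add: D_def E_def conj_assoc)
qed

end
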